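(* For all matrix compositions $\mathbf{a},\mathbf{b}\in\mathrm{Cmp}(\mathbb{N}_0)$, $$M_{\mathbf{a}}\,M_{\mathbf{b}}=\sum_{j,k\in\mathbb{N}}\ \sum_{\substack{p\in\mathrm{qSh}(\mathsf{rows}(\mathbf{a}),\mathsf{rows}(\mathbf{b});j)\\ q\in\mathrm{qSh}(\mathsf{cols}(\mathbf{a}),\mathsf{cols}(\mathbf{b});k)}}M_{\mathbf{c}^{p,q}},$$ where $\mathbf{c}^{p,q}$ is the $j\times k$ matrix composition with entries $\mathbf{c}^{p,q}_{x,y}=\sum_{u\in p^{-1}(x)}\sum_{v\in q^{-1}(y)}\mathrm{diag}(\mathbf{a},\mathbf{b})_{u,v}\in\mathbb{N}_0$. (If $\mathbf{a}$ or $\mathbf{b}$ is the empty composition $\mathsf{e}$, the right-hand side is understood as $M_{\mathbf{b}}$, respectively $M_{\mathbf{a}}$.)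
   Context: $\mathbb{K}$ is an integral domain, $\mathbb{N}=\{1,2,\ldots\}$, $\mathbb{N}_0=\{0\}\cup\mathbb{N}$. $\mathrm{Cmp}(\mathbb{N}_0)$ is the set of all matrices with entries in $\mathbb{N}_0$ (with at least one row and column) having no zero row and no zero column, together with an additional element $\mathsf{e}$, the empty composition. $\mathsf{rows}(\mathbf{a})$ and $\mathsf{cols}(\mathbf{a})$ are the numbers of rows and columns of $\mathbf{a}$; $\mathrm{diag}(\mathbf{a},\mathbf{b})$ is the block diagonal matrix with (not necessarily square) blocks $\mathbf{a}$ and $\mathbf{b}$ and zeros elsewhere. $(x_{\boldsymbol{i}})_{\boldsymbol{i}\in\mathbb{N}^2}$ is a family of commuting variables, and products are taken in the $\mathbb{K}$-algebra of formal power series of finite degree in $x$. For non-empty $\mathbf{a}$, $$M_{\mathbf{a}}=\sum_{\substack{\iota_1<\cdots<\iota_{\mathsf{rows}(\mathbf{a})}\\ \kappa_1<\cdots<\kappa_{\mathsf{cols}(\mathbf{a})}}}\ \prod_{s=1}^{\mathsf{rows}(\mathbf{a})}\prod_{t=1}^{\mathsf{cols}(\mathbf{a})}x_{\iota_s,\kappa_t}^{\mathbf{a}_{s,t}},$$ the sum being over all strictly increasing chains in $\mathbb{N}$, and $M_{\mathsf{e}}=1$. For $m,s,j\in\mathbb{N}$, $\mathrm{qSh}(m,s;j)$ is the set of surjections $q:\{1,\ldots,m+s\}\to\{1,\ldots,j\}$ with $q(1)<\cdots<q(m)$ and $q(m+1)<\cdots<q(m+s)$. *)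

theory Defs
  imports "HOL-Library.Poly_Mapping" "HOL-Library.FuncSet" "Jordan_Normal_Form.Matrix"
begin

section \<open>Formal power series of finite degree\<close>

text \<open>
  A monomial in commuting variables indexed by \<open>'v\<close> is its finitely supported exponent vector
  of type \<open>'v \<Rightarrow>\<^sub>0 nat\<close>; multiplying monomials is adding exponent vectors.
\<close>

definition mdeg :: "('v \<Rightarrow>\<^sub>0 nat) \<Rightarrow> nat"
  where "mdeg m = (\<Sum>v\<in>Poly_Mapping.keys m. Poly_Mapping.lookup m v)"

lemma mdeg_superset:
  assumes "finite A" "Poly_Mapping.keys m \<subseteq> A"
  shows "mdeg m = (\<Sum>v\<in>A. Poly_Mapping.lookup m v)"
  unfolding mdeg_def
  by (rule sum.mono_neutral_left) (use assms in \<open>auto simp: in_keys_iff\<close>)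

lemma mdeg_zero [simp]: "mdeg 0 = 0"
  by (simp add: mdeg_def)

lemma mdeg_single [simp]: "mdeg (Poly_Mapping.single v n) = n"
  by (simp add: mdeg_def)

lemma mdeg_add: "mdeg (a + b) = mdeg a + mdeg b"
proof -
  let ?A = "Poly_Mapping.keys a \<union> Poly_Mapping.keys b"
  have "mdeg (a + b) = (\<Sum>v\<in>?A. Poly_Mapping.lookup (a + b) v)"
    by (rule mdeg_superset) (auto simp: in_keys_iff lookup_add)
  also have "\<dots> = (\<Sum>v\<in>?A. Poly_Mapping.lookup a v) + (\<Sum>v\<in>?A. Poly_Mapping.lookup b v)"
    by (simp only: lookup_add sum.distrib)
  also have "\<dots> = mdeg a + mdeg b"
    by (subst (1 2) mdeg_superset[of ?A]) auto
  finally show ?thesis .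
qed

lemma finite_monomial_divisors: "finite {a. \<exists>b. a + b = (m :: 'v \<Rightarrow>\<^sub>0 nat)}"
proof -
  let ?F = "{f :: 'v \<Rightarrow> nat. \<forall>v. (v \<in> Poly_Mapping.keys m \<longrightarrow> f v \<in> {..mdeg m}) \<and>
    (v \<notin> Poly_Mapping.keys m \<longrightarrow> f v = 0)}"
  have "Poly_Mapping.lookup ` {a. \<exists>b. a + b = m} \<subseteq> ?F"
  proof (intro image_subsetI CollectI allI conjI impI)
    fix a v assume "a \<in> {a. \<exists>b. a + b = m}"
    then obtain b where m: "m = a + b" by auto
    have le: "Poly_Mapping.lookup a v \<le> Poly_Mapping.lookup m v"
      by (simp add: m lookup_add)
    show "Poly_Mapping.lookup a v \<in> {..mdeg m}" if "v \<in> Poly_Mapping.keys m"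
    proof -
      have "Poly_Mapping.lookup m v \<le> mdeg m"
        unfolding mdeg_def by (rule member_le_sum) (use that in auto)
      with le show ?thesis by simp
    qed
    show "Poly_Mapping.lookup a v = 0" if "v \<notin> Poly_Mapping.keys m"
      using le that by (simp add: in_keys_iff)
  qed
  moreover have "finite ?F"
    by (rule finite_set_of_finite_funs) auto
  ultimately have "finite (Poly_Mapping.lookup ` {a. \<exists>b. a + b = m})"
    by (rule finite_subset)
  then show ?thesis
    by (rule finite_imageD) (simp add: inj_on_def lookup_inject)
qed

lemma finite_monomial_splits: "finite {(a, b). a + b = (m :: 'v \<Rightarrow>\<^sub>0 nat)}"
proof (rule finite_subset)
  have "{(a, b). a + b = m} \<subseteq> {a. \<exists>b. a + b = m} \<times> {b. \<exists>a. a + b = m}"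
    by auto
  then show "{(a, b). a + b = m} \<subseteq> {a. \<exists>b. a + b = m} \<times> {b. \<exists>a. b + a = m}"
    by (simp add: add.commute)
qed (simp add: finite_monomial_divisors)

definition conv :: "(('v \<Rightarrow>\<^sub>0 nat) \<Rightarrow> 'k::semiring_0) \<Rightarrow> (('v \<Rightarrow>\<^sub>0 nat) \<Rightarrow> 'k) \<Rightarrow> ('v \<Rightarrow>\<^sub>0 nat) \<Rightarrow> 'k"
  where "conv f g m = (\<Sum>(a, b)\<in>{(a, b). a + b = m}. f a * g b)"

lemma conv_assoc: "conv (conv f g) h = conv f (conv g h)"
proof
  fix m :: "'a \<Rightarrow>\<^sub>0 nat"
  have "conv (conv f g) h m =
    (\<Sum>x\<in>{(p, c). p + c = m}. \<Sum>y\<in>{(a, b). a + b = fst x}. f (fst y) * g (snd y) * h (snd x))"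
    by (simp add: conv_def sum_distrib_right case_prod_unfold)
  also have "\<dots> = (\<Sum>(x, y)\<in>Sigma {(p, c). p + c = m} (\<lambda>x. {(a, b). a + b = fst x}).
      f (fst y) * g (snd y) * h (snd x))"
    by (rule sum.Sigma) (use finite_monomial_splits in auto)
  also have "\<dots> = (\<Sum>(x, y)\<in>Sigma {(a, q). a + q = m} (\<lambda>x. {(b, c). b + c = snd x}).
      f (fst x) * (g (fst y) * h (snd y)))"
    by (rule sum.reindex_bij_witness
        [where i = "\<lambda>(x, y). ((fst x + fst y, snd y), (fst x, fst y))"
           and j = "\<lambda>(x, y). ((fst y, snd y + snd x), (snd y, snd x))"])
       (auto simp: add.assoc mult.assoc)
  also have "\<dots> =
    (\<Sum>x\<in>{(a, q). a + q = m}. \<Sum>y\<in>{(b, c). b + c = snd x}. f (fst x) * (g (fst y) * h (snd y)))"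
    by (rule sum.Sigma[symmetric]) (use finite_monomial_splits in auto)
  also have "\<dots> = conv f (conv g h) m"
    by (simp add: conv_def sum_distrib_left case_prod_unfold)
  finally show "conv (conv f g) h m = conv f (conv g h) m" .
qed

lemma conv_commute: "conv f g = conv g (f :: _ \<Rightarrow> 'k::comm_semiring_0)"
  unfolding conv_def
  by (rule ext, rule sum.reindex_bij_witness[where i = prod.swap and j = prod.swap])
     (auto simp: add.commute mult.commute)

lemma conv_monom:
  "conv (\<lambda>m. if m = p then c else 0) f (p + n) = c * f n"
proof -
  have "conv (\<lambda>m. if m = p then c else 0) f (p + n) =
    (\<Sum>x\<in>{(p, n)}. (if fst x = p then c else 0) * f (snd x))"
    unfolding conv_def case_prod_unfold
    by (rule sum.mono_neutral_right)
       (use finite_monomial_splits[of "p + n"] in \<open>auto simp: case_prod_unfold\<close>)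
  then show ?thesis by simp
qed

lemma conv_nonzero:
  assumes "conv f g m \<noteq> 0"
  obtains a b where "m = a + b" "f a \<noteq> 0" "g b \<noteq> 0"
proof -
  have "\<exists>x\<in>{(a, b). a + b = m}. f (fst x) * g (snd x) \<noteq> 0"
    using assms unfolding conv_def case_prod_unfold
    by (rule sum.not_neutral_contains_not_neutral) blast
  then obtain a b where "a + b = m" "f a * g b \<noteq> 0" by auto
  then show thesis using that[of a b] by fastforce
qed

text \<open>Coefficient families over the monomials whose support has bounded degree.\<close>

typedef (overloaded) ('v, 'k::zero) fps_findeg =
  "{f :: ('v \<Rightarrow>\<^sub>0 nat) \<Rightarrow> 'k. \<exists>d. \<forall>m. f m \<noteq> 0 \<longrightarrow> mdeg m \<le> d}"
  morphisms coeff Abs_fps_findeg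
  by (rule exI[of _ "\<lambda>_. 0"]) simp

setup_lifting type_definition_fps_findeg

lemma fps_findeg_eqI: "(\<And>m. coeff f m = coeff g m) \<Longrightarrow> f = g"
  by (simp add: coeff_inject[symmetric] fun_eq_iff)

instantiation fps_findeg :: (type, comm_ring_1) comm_ring_1
begin

lift_definition zero_fps_findeg :: "('a, 'b) fps_findeg" is "\<lambda>_. 0"
  by simp

lift_definition one_fps_findeg :: "('a, 'b) fps_findeg" is "\<lambda>m. if m = 0 then 1 else 0"
  by (rule exI[of _ 0]) auto

lift_definition plus_fps_findeg :: "('a, 'b) fps_findeg \<Rightarrow> ('a, 'b) fps_findeg \<Rightarrow> ('a, 'b) fps_findeg"
  is "\<lambda>f g m. f m + g m"
proof -
  fix f g :: "('a \<Rightarrow>\<^sub>0 nat) \<Rightarrow> 'b"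
  assume "\<exists>d. \<forall>m. f m \<noteq> 0 \<longrightarrow> mdeg m \<le> d" "\<exists>d. \<forall>m. g m \<noteq> 0 \<longrightarrow> mdeg m \<le> d"
  then obtain d e where "\<forall>m. f m \<noteq> 0 \<longrightarrow> mdeg m \<le> d" "\<forall>m. g m \<noteq> 0 \<longrightarrow> mdeg m \<le> e" by auto
  then have "\<forall>m. f m + g m \<noteq> 0 \<longrightarrow> mdeg m \<le> max d e"
    by (metis add.right_neutral max.coboundedI1 max.coboundedI2 add.left_neutral)
  then show "\<exists>d. \<forall>m. f m + g m \<noteq> 0 \<longrightarrow> mdeg m \<le> d" ..
qed

lift_definition uminus_fps_findeg :: "('a, 'b) fps_findeg \<Rightarrow> ('a, 'b) fps_findeg"
  is "\<lambda>f m. - f m"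
  by simp

lift_definition minus_fps_findeg :: "('a, 'b) fps_findeg \<Rightarrow> ('a, 'b) fps_findeg \<Rightarrow> ('a, 'b) fps_findeg"
  is "\<lambda>f g m. f m - g m"
proof -
  fix f g :: "('a \<Rightarrow>\<^sub>0 nat) \<Rightarrow> 'b"
  assume "\<exists>d. \<forall>m. f m \<noteq> 0 \<longrightarrow> mdeg m \<le> d" "\<exists>d. \<forall>m. g m \<noteq> 0 \<longrightarrow> mdeg m \<le> d"
  then obtain d e where "\<forall>m. f m \<noteq> 0 \<longrightarrow> mdeg m \<le> d" "\<forall>m. g m \<noteq> 0 \<longrightarrow> mdeg m \<le> e" by auto
  then have "\<forall>m. f m - g m \<noteq> 0 \<longrightarrow> mdeg m \<le> max d e"
    by (metis diff_self max.coboundedI1 max.coboundedI2)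
  then show "\<exists>d. \<forall>m. f m - g m \<noteq> 0 \<longrightarrow> mdeg m \<le> d" ..
qed

lift_definition times_fps_findeg :: "('a, 'b) fps_findeg \<Rightarrow> ('a, 'b) fps_findeg \<Rightarrow> ('a, 'b) fps_findeg"
  is conv
proof -
  fix f g :: "('a \<Rightarrow>\<^sub>0 nat) \<Rightarrow> 'b"
  assume "\<exists>d. \<forall>m. f m \<noteq> 0 \<longrightarrow> mdeg m \<le> d" "\<exists>d. \<forall>m. g m \<noteq> 0 \<longrightarrow> mdeg m \<le> d"
  then obtain d e where "\<forall>m. f m \<noteq> 0 \<longrightarrow> mdeg m \<le> d" "\<forall>m. g m \<noteq> 0 \<longrightarrow> mdeg m \<le> e" by auto
  then have "\<forall>m. conv f g m \<noteq> 0 \<longrightarrow> mdeg m \<le> d + e"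
    by (auto elim!: conv_nonzero simp: mdeg_add add_mono)
  then show "\<exists>d. \<forall>m. conv f g m \<noteq> 0 \<longrightarrow> mdeg m \<le> d" ..
qed

instance
proof
  note [simp] = zero_fps_findeg.rep_eq one_fps_findeg.rep_eq plus_fps_findeg.rep_eq
    uminus_fps_findeg.rep_eq minus_fps_findeg.rep_eq times_fps_findeg.rep_eq
  fix f g h :: "('a, 'b) fps_findeg"
  show "f * g * h = f * (g * h)"
    by (rule fps_findeg_eqI) (simp add: conv_assoc)
  show "f * g = g * f"
    by (rule fps_findeg_eqI) (simp add: conv_commute[of "coeff f"])
  show "1 * f = f"
  proof (rule fps_findeg_eqI)
    fix m show "coeff (1 * f) m = coeff f m"
      using conv_monom[of 0 1 "coeff f" m] by simp
  qed
  show "(f + g) * h = f * h + g * h"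
    by (rule fps_findeg_eqI) (simp add: conv_def distrib_right sum.distrib case_prod_unfold)
  show "(0 :: ('a, 'b) fps_findeg) \<noteq> 1"
  proof
    assume "(0 :: ('a, 'b) fps_findeg) = 1"
    then have "coeff (0 :: ('a, 'b) fps_findeg) 0 = coeff (1 :: ('a, 'b) fps_findeg) 0" by (rule arg_cong)
    then show False by simp
  qed
qed (rule fps_findeg_eqI, simp add: algebra_simps zero_fps_findeg.rep_eq plus_fps_findeg.rep_eq
      uminus_fps_findeg.rep_eq minus_fps_findeg.rep_eq)+

end

lemma coeff_zero [simp]: "coeff 0 m = 0"
  by (simp add: zero_fps_findeg.rep_eq)

lemma coeff_add [simp]: "coeff (f + g) m = coeff f m + coeff g m"
  by (simp add: plus_fps_findeg.rep_eq)

lemma coeff_mult: "coeff (f * g) m = (\<Sum>(a, b)\<in>{(a, b). a + b = m}. coeff f a * coeff g b)"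
  by (simp add: times_fps_findeg.rep_eq conv_def)

definition monomial :: "('v \<Rightarrow>\<^sub>0 nat) \<Rightarrow> ('v, 'k::comm_ring_1) fps_findeg"
  where "monomial p = Abs_fps_findeg (\<lambda>m. if m = p then 1 else 0)"

lemma coeff_monomial: "coeff (monomial p) = (\<lambda>m. if m = p then 1 else 0)"
  unfolding monomial_def
  by (rule Abs_fps_findeg_inverse, rule CollectI, rule exI[of _ "mdeg p"]) simp

lemma monomial_zero: "monomial 0 = 1"
  by (rule fps_findeg_eqI) (simp add: coeff_monomial one_fps_findeg.rep_eq)

lemma monomial_mult: "monomial p * monomial q = (monomial (p + q) :: ('v, 'k::comm_ring_1) fps_findeg)"
proof (rule fps_findeg_eqI)
  fix m
  let ?f = "\<lambda>m. if m = p then 1 else (0::'k)" and ?g = "\<lambda>m. if m = q then 1 else (0::'k)"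
  have "conv ?f ?g m = (if m = p + q then 1 else 0)"
  proof (cases "m = p + q")
    case True
    have "conv ?f ?g (p + q) = 1 * ?g q"
      by (rule conv_monom)
    then show ?thesis by (simp only: True mult_1_left if_True refl)
  next
    case False
    have "conv ?f ?g m = 0"
    proof (rule ccontr)
      assume "conv ?f ?g m \<noteq> 0"
      then obtain a b where "m = a + b" "?f a \<noteq> 0" "?g b \<noteq> 0"
        by (rule conv_nonzero)
      moreover from this have "a = p" "b = q" by presburger+
      ultimately show False using False by blast
    qed
    with False show ?thesis by presburger
  qed
  then show "coeff (monomial p * monomial q) m = coeff (monomial (p + q) :: ('v, 'k) fps_findeg) m"
    unfolding times_fps_findeg.rep_eq coeff_monomial .
qed

lemma monomial_prod: "(\<Prod>i\<in>A. monomial (p i)) = monomial (\<Sum>i\<in>A. p i)"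
  by (induction A rule: infinite_finite_induct) (simp_all add: monomial_zero monomial_mult)

definition var :: "'v \<Rightarrow> ('v, 'k::comm_ring_1) fps_findeg"
  where "var v = monomial (Poly_Mapping.single v 1)"

lemma var_power: "var v ^ n = monomial (Poly_Mapping.single v n)"
  by (induction n) (simp_all add: var_def monomial_zero monomial_mult flip: single_add)


section \<open>Matrix compositions\<close>

text \<open>
  Rows, columns, the arguments and values of quasi-shuffles, and the index set of the variables
  are numbered from 0, as is the convention for the type \<open>nat mat\<close>: the entry \<open>a $$ (s, t)\<close> is the classical entry at position
  \<open>(s + 1, t + 1)\<close>, and the variable \<open>var (i, j)\<close> is the classical \<open>x\<close> at
  \<open>(i + 1, j + 1)\<close>.
\<close>

datatype matrix_composition = Empty_Comp | Comp "nat mat"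

definition is_composition_mat :: "nat mat \<Rightarrow> bool"
  where "is_composition_mat a \<longleftrightarrow>
    1 \<le> dim_row a \<and> 1 \<le> dim_col a \<and>
    (\<forall>s<dim_row a. row a s \<noteq> 0\<^sub>v (dim_col a)) \<and>
    (\<forall>t<dim_col a. col a t \<noteq> 0\<^sub>v (dim_row a))"

definition Cmp :: "matrix_composition set"
  where "Cmp = insert Empty_Comp (Comp ` {a. is_composition_mat a})"

lemma is_composition_mat_entries:
  assumes "is_composition_mat a"
  shows "s < dim_row a \<Longrightarrow> \<exists>t<dim_col a. a $$ (s, t) \<noteq> 0"
    and "t < dim_col a \<Longrightarrow> \<exists>s<dim_row a. a $$ (s, t) \<noteq> 0"
  using assms unfolding is_composition_mat_def by (auto simp: vec_eq_iff)


section \<open>The series of a matrix composition\<close>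

definition index_chains :: "nat \<Rightarrow> (nat \<Rightarrow> nat) set"
  where "index_chains r = {\<iota> \<in> {..<r} \<rightarrow>\<^sub>E UNIV. strict_mono_on {..<r} \<iota>}"

definition chain_monomial ::
    "nat mat \<Rightarrow> (nat \<Rightarrow> nat) \<times> (nat \<Rightarrow> nat) \<Rightarrow> (nat \<times> nat, 'k::comm_ring_1) fps_findeg"
  where "chain_monomial a =
    (\<lambda>(\<iota>, \<kappa>). \<Prod>s<dim_row a. \<Prod>t<dim_col a. var (\<iota> s, \<kappa> t) ^ (a $$ (s, t)))"

lemma chain_monomial_altdef:
  "chain_monomial a (\<iota>, \<kappa>) =
    monomial (\<Sum>s<dim_row a. \<Sum>t<dim_col a. Poly_Mapping.single (\<iota> s, \<kappa> t) (a $$ (s, t)))"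
  by (simp add: chain_monomial_def var_power monomial_prod)

lemma mdeg_sum: "mdeg (\<Sum>i\<in>A. p i) = (\<Sum>i\<in>A. mdeg (p i))"
  by (induction A rule: infinite_finite_induct) (simp_all add: mdeg_add)

lemma mdeg_chain_monomial:
  assumes "coeff (chain_monomial a c) m \<noteq> 0"
  shows "mdeg m = (\<Sum>s<dim_row a. \<Sum>t<dim_col a. a $$ (s, t))"
  using assms
  by (cases c) (auto simp: chain_monomial_altdef coeff_monomial mdeg_sum split: if_splits)

text \<open>
  The sum over all pairs of chains is an infinite sum of formal power series, hence formed
  coefficientwise. For every composition matrix only finitely many summands contribute to a given
  coefficient, see \<open>finite_contributing_chains\<close> below.
\<close>

definition M_mat :: "nat mat \<Rightarrow> (nat \<times> nat, 'k::comm_ring_1) fps_findeg"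
  where "M_mat a = Abs_fps_findeg (\<lambda>m.
    \<Sum>c\<in>{c \<in> index_chains (dim_row a) \<times> index_chains (dim_col a).
        coeff (chain_monomial a c :: (nat \<times> nat, 'k) fps_findeg) m \<noteq> 0}.
      coeff (chain_monomial a c) m)"

lemma coeff_M_mat:
  "coeff (M_mat a :: (nat \<times> nat, 'k::comm_ring_1) fps_findeg) m =
    (\<Sum>c\<in>{c \<in> index_chains (dim_row a) \<times> index_chains (dim_col a).
        coeff (chain_monomial a c :: (nat \<times> nat, 'k) fps_findeg) m \<noteq> 0}.
      coeff (chain_monomial a c) m)"
proof -
  let ?S = "\<lambda>m. \<Sum>c\<in>{c \<in> index_chains (dim_row a) \<times> index_chains (dim_col a).
        coeff (chain_monomial a c :: (nat \<times> nat, 'k) fps_findeg) m \<noteq> 0}.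
      coeff (chain_monomial a c :: (nat \<times> nat, 'k) fps_findeg) m"
  have "mdeg m \<le> (\<Sum>s<dim_row a. \<Sum>t<dim_col a. a $$ (s, t))" if "?S m \<noteq> 0" for m
  proof -
    from that obtain c where "coeff (chain_monomial a c :: (nat \<times> nat, 'k) fps_findeg) m \<noteq> 0"
      by (rule sum.not_neutral_contains_not_neutral)
    then show ?thesis by (simp add: mdeg_chain_monomial)
  qed
  then have "?S \<in> {f. \<exists>d. \<forall>m. f m \<noteq> 0 \<longrightarrow> mdeg m \<le> d}" by blast
  then show ?thesis
    unfolding M_mat_def by (simp add: Abs_fps_findeg_inverse)
qed

lemma keys_chain_exponent:
  assumes "s < dim_row a" "t < dim_col a" "a $$ (s, t) \<noteq> 0"
  shows "(\<iota> s, \<kappa> t) \<in> Poly_Mapping.keys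
    (\<Sum>s<dim_row a. \<Sum>t<dim_col a. Poly_Mapping.single (\<iota> s, \<kappa> t) (a $$ (s, t) :: nat))"
proof -
  let ?x = "\<lambda>s' t'. Poly_Mapping.lookup (Poly_Mapping.single (\<iota> s', \<kappa> t') (a $$ (s', t'))) (\<iota> s, \<kappa> t)"
  have "?x s t \<le> (\<Sum>t'<dim_col a. ?x s t')"
    by (rule member_le_sum[where f = "?x s"]) (use assms in auto)
  also have "\<dots> \<le> (\<Sum>s'<dim_row a. \<Sum>t'<dim_col a. ?x s' t')"
    by (rule member_le_sum[where f = "\<lambda>s'. \<Sum>t'<dim_col a. ?x s' t'"]) (use assms in auto)
  finally have "0 < (\<Sum>s'<dim_row a. \<Sum>t'<dim_col a. ?x s' t')"
    using assms by simp
  then show ?thesis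
    by (simp add: in_keys_iff lookup_sum del: sum_eq_0_iff)
qed

lemma finite_contributing_chains:
  assumes "is_composition_mat a"
  shows "finite {c \<in> index_chains (dim_row a) \<times> index_chains (dim_col a).
    coeff (chain_monomial a c :: (nat \<times> nat, 'k::comm_ring_1) fps_findeg) m \<noteq> 0}"
proof (rule finite_subset)
  show "{c \<in> index_chains (dim_row a) \<times> index_chains (dim_col a).
      coeff (chain_monomial a c :: (nat \<times> nat, 'k) fps_findeg) m \<noteq> 0}
    \<subseteq> ({..<dim_row a} \<rightarrow>\<^sub>E fst ` Poly_Mapping.keys m) \<times> ({..<dim_col a} \<rightarrow>\<^sub>E snd ` Poly_Mapping.keys m)"
  proof (clarify, intro conjI)
    fix \<iota> \<kappa>
    assume c: "\<iota> \<in> index_chains (dim_row a)" "\<kappa> \<in> index_chains (dim_col a)"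
      and "coeff (chain_monomial a (\<iota>, \<kappa>) :: (nat \<times> nat, 'k) fps_findeg) m \<noteq> 0"
    then have m: "m = (\<Sum>s<dim_row a. \<Sum>t<dim_col a. Poly_Mapping.single (\<iota> s, \<kappa> t) (a $$ (s, t)))"
      by (auto simp: chain_monomial_altdef coeff_monomial split: if_splits)
    have "\<iota> s \<in> fst ` Poly_Mapping.keys m" if s: "s < dim_row a" for s
    proof -
      obtain t where "t < dim_col a" "a $$ (s, t) \<noteq> 0"
        using is_composition_mat_entries(1)[OF assms s] by auto
      from keys_chain_exponent[where \<iota> = \<iota> and \<kappa> = \<kappa>, OF s this]
      show ?thesis unfolding m by force
    qed
    with c(1) show "\<iota> \<in> {..<dim_row a} \<rightarrow>\<^sub>E fst ` Poly_Mapping.keys m"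
      by (auto simp: index_chains_def PiE_iff)
    have "\<kappa> t \<in> snd ` Poly_Mapping.keys m" if t: "t < dim_col a" for t
    proof -
      obtain s where "s < dim_row a" "a $$ (s, t) \<noteq> 0"
        using is_composition_mat_entries(2)[OF assms t] by auto
      from keys_chain_exponent[where \<iota> = \<iota> and \<kappa> = \<kappa>, OF this(1) t this(2)]
      show ?thesis unfolding m by force
    qed
    with c(2) show "\<kappa> \<in> {..<dim_col a} \<rightarrow>\<^sub>E snd ` Poly_Mapping.keys m"
      by (auto simp: index_chains_def PiE_iff)
  qed
qed (auto intro!: finite_PiE)

fun M :: "matrix_composition \<Rightarrow> (nat \<times> nat, 'k::comm_ring_1) fps_findeg"
  where
    "M Empty_Comp = 1"
  | "M (Comp a) = M_mat a"


section \<open>Quasi-shuffles\<close>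

definition qSh :: "nat \<Rightarrow> nat \<Rightarrow> nat \<Rightarrow> (nat \<Rightarrow> nat) set"
  where "qSh m s j = {q \<in> {..<m + s} \<rightarrow>\<^sub>E {..<j}.
    q ` {..<m + s} = {..<j} \<and> strict_mono_on {..<m} q \<and> strict_mono_on {m..<m + s} q}"

definition qsh_mat :: "nat mat \<Rightarrow> nat mat \<Rightarrow> nat \<Rightarrow> nat \<Rightarrow> (nat \<Rightarrow> nat) \<Rightarrow> (nat \<Rightarrow> nat) \<Rightarrow> nat mat"
  where "qsh_mat a b j k p q = mat j k (\<lambda>(x, y).
    \<Sum>u\<in>{u. u < dim_row a + dim_row b \<and> p u = x}.
      \<Sum>v\<in>{v. v < dim_col a + dim_col b \<and> q v = y}. diag_block_mat [a, b] $$ (u, v))"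

text \<open>
  The index set of the sum over all \<open>j\<close>, \<open>k\<close>, \<open>p\<close> and \<open>q\<close>. It is finite, since a surjection
  onto \<open>j\<close> elements needs at least \<open>j\<close> arguments.
\<close>

definition qsh_index :: "nat mat \<Rightarrow> nat mat \<Rightarrow> (nat \<times> nat \<times> (nat \<Rightarrow> nat) \<times> (nat \<Rightarrow> nat)) set"
  where "qsh_index a b = {(j, k, p, q). 1 \<le> j \<and> 1 \<le> k \<and>
    p \<in> qSh (dim_row a) (dim_row b) j \<and> q \<in> qSh (dim_col a) (dim_col b) k}"

lemma finite_qSh: "finite (qSh m s j)"
  by (rule finite_subset[of _ "{..<m + s} \<rightarrow>\<^sub>E {..<j}"]) (auto simp: qSh_def intro!: finite_PiE)

lemma qSh_bound:
  assumes "q \<in> qSh m s j"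
  shows "j \<le> m + s"
  using assms card_image_le[of "{..<m + s}" q] by (simp add: qSh_def)

lemma finite_qsh_index: "finite (qsh_index a b)"
proof (rule finite_subset)
  let ?R = "dim_row a + dim_row b" and ?C = "dim_col a + dim_col b"
  show "qsh_index a b \<subseteq> {..?R} \<times> {..?C} \<times>
      (\<Union>j\<le>?R. qSh (dim_row a) (dim_row b) j) \<times> (\<Union>k\<le>?C. qSh (dim_col a) (dim_col b) k)"
    by (auto simp: qsh_index_def dest: qSh_bound)
qed (auto simp: finite_qSh)

lemma is_composition_qsh_mat:
  assumes a: "is_composition_mat a" and b: "is_composition_mat b"
    and ind: "(j, k, p, q) \<in> qsh_index a b"
  shows "is_composition_mat (qsh_mat a b j k p q)"
proof -
  let ?D = "diag_block_mat [a, b]"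
  let ?R = "dim_row a + dim_row b" and ?C = "dim_col a + dim_col b"
  have jk: "1 \<le> j" "1 \<le> k"
    and p: "p ` {..<?R} = {..<j}" and q: "q ` {..<?C} = {..<k}"
    using ind by (auto simp: qsh_index_def qSh_def)
  have D: "?D $$ (u, v) = (if u < dim_row a then if v < dim_col a then a $$ (u, v) else 0
      else if v < dim_col a then 0 else b $$ (u - dim_row a, v - dim_col a))"
    if "u < ?R" "v < ?C" for u v
    using that by (auto simp: Let_def)
  have rows: "\<exists>v<?C. ?D $$ (u, v) \<noteq> 0" if u: "u < ?R" for u
  proof (cases "u < dim_row a")
    case True
    then obtain v where "v < dim_col a" "a $$ (u, v) \<noteq> 0"
      using is_composition_mat_entries(1)[OF a] by blast
    with True u show ?thesis by (intro exI[of _ v]) (simp add: D del: diag_block_mat.simps)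
  next
    case False
    with u have "u - dim_row a < dim_row b" by linarith
    then obtain v where "v < dim_col b" "b $$ (u - dim_row a, v) \<noteq> 0"
      using is_composition_mat_entries(1)[OF b] by blast
    with False u show ?thesis
      by (intro exI[of _ "dim_col a + v"]) (simp add: D del: diag_block_mat.simps)
  qed
  have cols: "\<exists>u<?R. ?D $$ (u, v) \<noteq> 0" if v: "v < ?C" for v
  proof (cases "v < dim_col a")
    case True
    then obtain u where "u < dim_row a" "a $$ (u, v) \<noteq> 0"
      using is_composition_mat_entries(2)[OF a] by blast
    with True v show ?thesis by (intro exI[of _ u]) (simp add: D del: diag_block_mat.simps)
  next
    case False
    with v have "v - dim_col a < dim_col b" by linarith
    then obtain u where "u < dim_row b" "b $$ (u, v - dim_col a) \<noteq> 0"
      using is_composition_mat_entries(2)[OF b] by blast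
    with False v show ?thesis
      by (intro exI[of _ "dim_row a + u"]) (simp add: D del: diag_block_mat.simps)
  qed
  have entry: "p u < j \<and> q v < k \<and> qsh_mat a b j k p q $$ (p u, q v) \<noteq> 0"
    if "u < ?R" "v < ?C" "?D $$ (u, v) \<noteq> 0" for u v
  proof -
    have lt: "p u < j" "q v < k" using that p q by auto
    have "?D $$ (u, v) \<le> (\<Sum>v'\<in>{v'. v' < ?C \<and> q v' = q v}. ?D $$ (u, v'))"
      by (rule member_le_sum[where f = "\<lambda>v'. ?D $$ (u, v')"]) (use that in auto)
    also have "\<dots> \<le> (\<Sum>u'\<in>{u'. u' < ?R \<and> p u' = p u}. \<Sum>v'\<in>{v'. v' < ?C \<and> q v' = q v}. ?D $$ (u', v'))"
      by (rule member_le_sum[where f = "\<lambda>u'. \<Sum>v'\<in>{v'. v' < ?C \<and> q v' = q v}. ?D $$ (u', v')"])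
         (use that in auto)
    also have "\<dots> = qsh_mat a b j k p q $$ (p u, q v)"
      using lt by (simp add: qsh_mat_def del: diag_block_mat.simps)
    finally show ?thesis using that lt by auto
  qed
  let ?c = "qsh_mat a b j k p q"
  have dim: "dim_row ?c = j" "dim_col ?c = k"
    by (simp_all add: qsh_mat_def)
  have r: "\<exists>y<k. ?c $$ (x, y) \<noteq> 0" if "x < j" for x
  proof -
    from that p obtain u where "u < ?R" "x = p u" by (metis imageE lessThan_iff)
    with rows entry show ?thesis by blast
  qed
  have c: "\<exists>x<j. ?c $$ (x, y) \<noteq> 0" if "y < k" for y
  proof -
    from that q obtain v where "v < ?C" "y = q v" by (metis imageE lessThan_iff)
    with cols entry show ?thesis by blast
  qed
  show ?thesis
    unfolding is_composition_mat_def dim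
  proof (intro conjI allI impI jk)
    fix x assume x: "x < j"
    then obtain y where "y < k" "?c $$ (x, y) \<noteq> 0" using r by blast
    moreover from this x have "row ?c x $ y = ?c $$ (x, y)" by (simp add: dim)
    ultimately show "row ?c x \<noteq> 0\<^sub>v k" by auto
  next
    fix y assume y: "y < k"
    then obtain x where "x < j" "?c $$ (x, y) \<noteq> 0" using c by blast
    moreover from this y have "col ?c y $ x = ?c $$ (x, y)" by (simp add: dim)
    ultimately show "col ?c y \<noteq> 0\<^sub>v j" by auto
  qed
qed

end

theory Submission
  imports Defs "HOL-Library.Infinite_Set"
begin

text \<open>
  The coefficient of \<open>M_mat a\<close> at a monomial \<open>m\<close> counts the pairs of chains that substitute to
  \<open>m\<close>, so the coefficient of a product counts pairs of such pairs whose exponents add up to \<open>m\<close>.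
  The idea is to merge chains: an increasing chain of length \<open>r\<close> and one of length \<open>s\<close> form
  a word of length \<open>r + s\<close>, and a word \<open>w\<close> factors in exactly one way as \<open>w = \<iota> \<circ> p\<close> with \<open>p\<close> onto
  an initial segment \<open>{..<j}\<close> and \<open>\<iota>\<close> increasing on it (\<open>\<iota>\<close> enumerates the range of \<open>w\<close>). The word is
  increasing on both blocks if and only if \<open>p\<close> is a quasi-shuffle. The factorization exists by
  \<open>split_word_surj\<close> and is unique by \<open>split_word_inject\<close>.

  Applied to row indices and to column indices, this matches the pairs counted by the product with
  a quasi-shuffle \<open>p\<close> of rows, a quasi-shuffle \<open>q\<close> of columns and one pair of chains for
  \<open>qsh_mat a b j k p q\<close>. The exponents agree because the entries of that matrix collect exactly
  those entries of the block diagonal matrix that are placed on the same variable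
  (\<open>chain_exponent_qsh_mat\<close>). Comparing the two counts coefficientwise proves the theorem.
\<close>

section \<open>Coefficients as numbers of pairs of chains\<close>

definition chain_exponent :: "nat mat \<Rightarrow> (nat \<Rightarrow> nat) \<times> (nat \<Rightarrow> nat) \<Rightarrow> (nat \<times> nat \<Rightarrow>\<^sub>0 nat)"
  where "chain_exponent a =
    (\<lambda>(\<iota>, \<kappa>). \<Sum>s<dim_row a. \<Sum>t<dim_col a. Poly_Mapping.single (\<iota> s, \<kappa> t) (a $$ (s, t)))"

definition chains_with_exponent ::
    "nat mat \<Rightarrow> (nat \<times> nat \<Rightarrow>\<^sub>0 nat) \<Rightarrow> ((nat \<Rightarrow> nat) \<times> (nat \<Rightarrow> nat)) set"
  where "chains_with_exponent a m =
    {c \<in> index_chains (dim_row a) \<times> index_chains (dim_col a). chain_exponent a c = m}"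

lemma chain_monomial_exponent: "chain_monomial a c = monomial (chain_exponent a c)"
  by (cases c) (simp add: chain_monomial_altdef chain_exponent_def)

lemma contributing_chains_eq:
  "{c \<in> index_chains (dim_row a) \<times> index_chains (dim_col a).
      coeff (chain_monomial a c :: (nat \<times> nat, 'k::comm_ring_1) fps_findeg) m \<noteq> 0}
    = chains_with_exponent a m"
  by (auto simp: chains_with_exponent_def chain_monomial_exponent coeff_monomial)

lemma coeff_M_mat_card:
  "coeff (M_mat a :: (nat \<times> nat, 'k::comm_ring_1) fps_findeg) m
    = of_nat (card (chains_with_exponent a m))"
proof -
  have "coeff (M_mat a :: (nat \<times> nat, 'k) fps_findeg) m
      = (\<Sum>c\<in>chains_with_exponent a m. coeff (chain_monomial a c) m)"
    by (simp only: coeff_M_mat contributing_chains_eq)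
  also have "\<dots> = (\<Sum>c\<in>chains_with_exponent a m. 1)"
    by (rule sum.cong)
       (auto simp: chains_with_exponent_def chain_monomial_exponent coeff_monomial)
  finally show ?thesis by simp
qed

lemma finite_chains_with_exponent:
  assumes "is_composition_mat a"
  shows "finite (chains_with_exponent a m)"
  using finite_contributing_chains[OF assms, where ?'k = int, of m]
  by (simp only: contributing_chains_eq)

definition product_chains ::
    "nat mat \<Rightarrow> nat mat \<Rightarrow> (nat \<times> nat \<Rightarrow>\<^sub>0 nat) \<Rightarrow>
      (((nat \<Rightarrow> nat) \<times> (nat \<Rightarrow> nat)) \<times> ((nat \<Rightarrow> nat) \<times> (nat \<Rightarrow> nat))) set"
  where "product_chains a b m =
    {(c, d). c \<in> index_chains (dim_row a) \<times> index_chains (dim_col a) \<and>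
      d \<in> index_chains (dim_row b) \<times> index_chains (dim_col b) \<and>
      chain_exponent a c + chain_exponent b d = m}"

lemma coeff_M_mat_mult_card:
  assumes "is_composition_mat a" "is_composition_mat b"
  shows "coeff (M_mat a * M_mat b :: (nat \<times> nat, 'k::comm_ring_1) fps_findeg) m
    = of_nat (card (product_chains a b m))"
proof -
  let ?S = "{(m1, m2). m1 + m2 = m}"
  let ?C = "\<lambda>(m1, m2). chains_with_exponent a m1 \<times> chains_with_exponent b m2"
  have U: "product_chains a b m = (\<Union>x\<in>?S. ?C x)"
    by (auto simp: product_chains_def chains_with_exponent_def)
  have "card (product_chains a b m) = (\<Sum>x\<in>?S. card (?C x))"
    unfolding U
  proof (rule card_UN_disjoint)
    show "finite ?S" by (rule finite_monomial_splits)
    show "\<forall>x\<in>?S. finite (?C x)"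
      using assms by (auto simp: finite_chains_with_exponent)
    show "\<forall>x\<in>?S. \<forall>y\<in>?S. x \<noteq> y \<longrightarrow> ?C x \<inter> ?C y = {}"
      by (auto simp: chains_with_exponent_def)
  qed
  then show ?thesis
    by (simp add: coeff_mult coeff_M_mat_card case_prod_unfold card_cartesian_product)
qed

section \<open>Merging increasing chains\<close>

text \<open>
  The two blocks of the word \<open>\<iota> \<circ> p\<close>, restricted because elements of \<open>index_chains\<close> are
  \<open>undefined\<close> outside their domain.
\<close>

definition split_word ::
    "nat \<Rightarrow> nat \<Rightarrow> (nat \<Rightarrow> nat) \<Rightarrow> (nat \<Rightarrow> nat) \<Rightarrow> (nat \<Rightarrow> nat) \<times> (nat \<Rightarrow> nat)"
  where "split_word r s p \<iota> =
    (restrict (\<lambda>u. \<iota> (p u)) {..<r}, restrict (\<lambda>i. \<iota> (p (r + i))) {..<s})"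

lemma index_chains_eqI:
  assumes "\<iota> \<in> index_chains j" "\<iota>' \<in> index_chains j" "\<iota> ` {..<j} = \<iota>' ` {..<j}"
  shows "\<iota> = \<iota>'"
proof -
  have sorted: "map f [0..<j] = sorted_list_of_set (f ` {..<j})" if "f \<in> index_chains j" for f
  proof -
    have mono: "strict_mono_on {..<j} f" using that by (simp add: index_chains_def)
    then have "sorted_wrt (<) (map f [0..<j])"
      by (auto simp: sorted_wrt_iff_nth_less strict_mono_on_def)
    then have "sorted_list_of_set (set (map f [0..<j])) = map f [0..<j]"
      by (meson sorted_list_of_set.idem_if_sorted_distinct strict_sorted_iff)
    then show ?thesis by (simp add: atLeast0LessThan)
  qed
  have "map \<iota> [0..<j] = map \<iota>' [0..<j]"
    using assms by (simp only: sorted)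
  then have "\<iota> x = \<iota>' x" if "x < j" for x
    using that by (metis atLeast0LessThan atLeast_upt lessThan_iff map_eq_conv)
  then show ?thesis
    using assms(1,2) by (intro PiE_ext[of \<iota> "{..<j}" "\<lambda>_. UNIV"]) (auto simp: index_chains_def)
qed

lemma split_word_mem:
  assumes "p \<in> qSh r s j" "\<iota> \<in> index_chains j"
  shows "split_word r s p \<iota> \<in> index_chains r \<times> index_chains s"
proof -
  have p: "p u < j" if "u < r + s" for u using assms that by (auto simp: qSh_def)
  have mono: "\<iota> x < \<iota> y" if "x < y" "y < j" for x y
    using assms(2) that by (auto simp: index_chains_def strict_mono_on_def)
  have "p u < p v" if "u < v" "v < r" for u v
    using assms(1) that by (auto simp: qSh_def strict_mono_on_def)
  moreover have "p (r + u) < p (r + v)" if "u < v" "v < s" for u v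
    using assms(1) that by (auto simp: qSh_def strict_mono_on_def)
  ultimately show ?thesis
    using p mono by (auto simp: split_word_def index_chains_def strict_mono_on_def)
qed

lemma split_word_eqD:
  assumes "split_word r s p \<iota> = split_word r s p' \<iota>'" "u < r + s"
  shows "\<iota> (p u) = \<iota>' (p' u)"
proof (cases "u < r")
  case True
  have "fst (split_word r s p \<iota>) u = fst (split_word r s p' \<iota>') u" using assms by simp
  with True show ?thesis by (simp add: split_word_def)
next
  case False
  have "snd (split_word r s p \<iota>) (u - r) = snd (split_word r s p' \<iota>') (u - r)" using assms by simp
  moreover have "r + (u - r) = u" "u - r < s" using False assms(2) by auto
  ultimately show ?thesis by (simp add: split_word_def)
qed

text \<open>
  The range of the word \<open>\<iota> \<circ> p\<close> is the range of \<open>\<iota>\<close>. So the word determines \<open>j\<close> as a cardinality,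
  \<open>\<iota>\<close> as the increasing enumeration, and \<open>p\<close> because \<open>\<iota>\<close> is injective.
\<close>

lemma split_word_inject:
  assumes p: "p \<in> qSh r s j" and \<iota>: "\<iota> \<in> index_chains j"
    and p': "p' \<in> qSh r s j'" and \<iota>': "\<iota>' \<in> index_chains j'"
    and eq: "split_word r s p \<iota> = split_word r s p' \<iota>'"
  shows "j = j' \<and> p = p' \<and> \<iota> = \<iota>'"
proof -
  note word = split_word_eqD[OF eq]
  have range: "f ` {..<i} = (\<lambda>u. f (g u)) ` {..<r + s}" if "g \<in> qSh r s i" for f g :: "nat \<Rightarrow> nat" and i
    using that by (simp add: qSh_def flip: image_image)
  have im: "\<iota> ` {..<j} = \<iota>' ` {..<j'}"
    unfolding range[OF p] range[OF p'] using word by (intro image_cong) auto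
  have inj: "inj_on f {..<i}" if "f \<in> index_chains i" for f i
    using that by (auto simp: index_chains_def intro: strict_mono_on_imp_inj_on)
  have j: "j = j'"
    using arg_cong[OF im, of card] by (simp add: card_image inj \<iota> \<iota>')
  have chain: "\<iota> = \<iota>'"
    using index_chains_eqI \<iota> \<iota>' im j by blast
  have "p u = p' u" if "u < r + s" for u
  proof (rule inj_onD[OF inj[OF \<iota>]])
    show "\<iota> (p u) = \<iota> (p' u)" using word[OF that] chain by simp
  qed (use p p' j that in \<open>auto simp: qSh_def\<close>)
  then have "p = p'"
    using p p' j by (intro PiE_ext[of p "{..<r + s}" "\<lambda>_. {..<j}"]) (auto simp: qSh_def)
  with j chain show ?thesis by simp
qed

text \<open>
  The chain \<open>\<iota>\<close> has to enumerate the range of the concatenated word \<open>w\<close> in increasing order, and \<open>p\<close>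
  sends each position to the rank of its letter. Ranks compare as letters do, so \<open>p\<close> is increasing
  wherever \<open>w\<close> is.
\<close>

lemma split_word_surj:
  assumes "\<alpha> \<in> index_chains r" "\<beta> \<in> index_chains s"
  obtains j p \<iota> where "p \<in> qSh r s j" "\<iota> \<in> index_chains j" "split_word r s p \<iota> = (\<alpha>, \<beta>)"
proof -
  define w where "w u = (if u < r then \<alpha> u else \<beta> (u - r))" for u
  let ?I = "w ` {..<r + s}"
  let ?j = "card ?I"
  obtain h where h: "bij_betw h {..<?j} ?I" "strict_mono_on {..<?j} h"
    using ex_bij_betw_strict_mono_card[of ?I] by auto
  define \<iota> where "\<iota> = restrict h {..<?j}"
  define p where "p = restrict (\<lambda>u. the_inv_into {..<?j} h (w u)) {..<r + s}"
  have inj: "inj_on h {..<?j}" and im: "h ` {..<?j} = ?I"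
    using h(1) by (auto simp: bij_betw_def)
  have p_less: "p u < ?j" if "u < r + s" for u
    using the_inv_into_into[OF inj, of "w u" "{..<?j}"] that im by (auto simp: p_def)
  have hp: "h (p u) = w u" if "u < r + s" for u
    using f_the_inv_into_f[OF inj, of "w u"] that im by (auto simp: p_def)
  have p_mono: "p u < p v" if "u < r + s" "v < r + s" "w u < w v" for u v
    using that h(2) p_less hp strict_mono_on_less by (metis lessThan_iff)
  have "strict_mono_on {..<r} p"
    by (rule strict_mono_onI, rule p_mono)
       (use assms(1) in \<open>auto simp: w_def index_chains_def strict_mono_on_def\<close>)
  moreover have "strict_mono_on {r..<r + s} p"
  proof (rule strict_mono_onI, rule p_mono)
    fix u v assume uv: "u \<in> {r..<r + s}" "v \<in> {r..<r + s}" "u < v"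
    then have "u - r < v - r" "v - r < s" by auto
    moreover have "strict_mono_on {..<s} \<beta>" using assms(2) by (simp add: index_chains_def)
    ultimately have "\<beta> (u - r) < \<beta> (v - r)" by (auto intro: strict_mono_onD)
    with uv show "w u < w v" by (simp add: w_def)
  qed auto
  moreover have "p ` {..<r + s} = {..<?j}"
  proof
    show "p ` {..<r + s} \<subseteq> {..<?j}" using p_less by auto
    show "{..<?j} \<subseteq> p ` {..<r + s}"
    proof
      fix x assume x: "x \<in> {..<?j}"
      then obtain u where u: "u < r + s" "h x = w u" using im by blast
      then have "x = p u" using inj_onD[OF inj, of x "p u"] x hp p_less by auto
      with u show "x \<in> p ` {..<r + s}" by simp
    qed
  qed
  moreover have "p \<in> {..<r + s} \<rightarrow>\<^sub>E {..<?j}"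
    using p_less by (auto simp: p_def)
  ultimately have 1: "p \<in> qSh r s ?j" by (simp add: qSh_def)
  have 2: "\<iota> \<in> index_chains ?j"
    using h(2) by (auto simp: \<iota>_def index_chains_def strict_mono_on_def)
  have word: "\<iota> (p u) = w u" if "u < r + s" for u
    using that p_less hp by (simp add: \<iota>_def)
  have \<alpha>: "restrict (\<lambda>u. \<iota> (p u)) {..<r} = \<alpha>"
  proof -
    have "restrict (\<lambda>u. \<iota> (p u)) {..<r} = restrict \<alpha> {..<r}"
      by (rule restrict_ext) (simp add: word, simp add: w_def)
    also have "\<dots> = \<alpha>" using assms(1) by (auto simp: index_chains_def intro: PiE_restrict)
    finally show ?thesis .
  qed
  have \<beta>: "restrict (\<lambda>i. \<iota> (p (r + i))) {..<s} = \<beta>"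
  proof -
    have "restrict (\<lambda>i. \<iota> (p (r + i))) {..<s} = restrict \<beta> {..<s}"
      by (rule restrict_ext) (simp add: word, simp add: w_def)
    also have "\<dots> = \<beta>" using assms(2) by (auto simp: index_chains_def intro: PiE_restrict)
    finally show ?thesis .
  qed
  have 3: "split_word r s p \<iota> = (\<alpha>, \<beta>)"
    unfolding split_word_def \<alpha> \<beta> ..
  from 1 2 3 show thesis by (rule that)
qed

section \<open>Exponents under quasi-shuffles\<close>

lemma sum_lessThan_add:
  "(\<Sum>u<m + n. f u) = (\<Sum>u<m. f u) + (\<Sum>i<n. f (m + i :: nat) :: 'a::comm_monoid_add)"
  by (induction n) (simp_all add: add.assoc)

lemma single_sum: "Poly_Mapping.single v (\<Sum>i\<in>A. f i) = (\<Sum>i\<in>A. Poly_Mapping.single v (f i))"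
  by (induction A rule: infinite_finite_induct) (simp_all add: single_add)

text \<open>
  Summing over \<open>x\<close> and \<open>y\<close> and then over the fibres of \<open>p\<close> and \<open>q\<close> is summing over all positions
  \<open>(u, v)\<close> of the block diagonal matrix; its off-diagonal blocks contribute nothing.
\<close>

lemma chain_exponent_qsh_mat:
  assumes p: "p \<in> qSh (dim_row a) (dim_row b) j" and q: "q \<in> qSh (dim_col a) (dim_col b) k"
  shows "chain_exponent (qsh_mat a b j k p q) (\<iota>, \<kappa>) =
    chain_exponent a (fst (split_word (dim_row a) (dim_row b) p \<iota>),
                      fst (split_word (dim_col a) (dim_col b) q \<kappa>)) +
    chain_exponent b (snd (split_word (dim_row a) (dim_row b) p \<iota>),
                      snd (split_word (dim_col a) (dim_col b) q \<kappa>))"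
proof -
  let ?R = "dim_row a + dim_row b" and ?C = "dim_col a + dim_col b"
  define D where "D u v = diag_block_mat [a, b] $$ (u, v)" for u v
  have D: "D u v = (if u < dim_row a then if v < dim_col a then a $$ (u, v) else 0
      else if v < dim_col a then 0 else b $$ (u - dim_row a, v - dim_col a))"
    if "u < ?R" "v < ?C" for u v
    using that by (auto simp: Let_def D_def)
  let ?g = "\<lambda>u v. Poly_Mapping.single (\<iota> (p u), \<kappa> (q v)) (D u v)"
  have pR: "p ` {..<?R} \<subseteq> {..<j}" and qC: "q ` {..<?C} \<subseteq> {..<k}"
    using p q by (auto simp: qSh_def)
  have "chain_exponent (qsh_mat a b j k p q) (\<iota>, \<kappa>) =
      (\<Sum>x<j. \<Sum>y<k. \<Sum>u\<in>{u \<in> {..<?R}. p u = x}. \<Sum>v\<in>{v \<in> {..<?C}. q v = y}.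
        Poly_Mapping.single (\<iota> x, \<kappa> y) (D u v))"
    by (simp add: chain_exponent_def qsh_mat_def single_sum flip: D_def del: diag_block_mat.simps)
  also have "\<dots> = (\<Sum>x<j. \<Sum>y<k. \<Sum>u\<in>{u \<in> {..<?R}. p u = x}. \<Sum>v\<in>{v \<in> {..<?C}. q v = y}. ?g u v)"
    by (intro sum.cong) auto
  also have "\<dots> = (\<Sum>x<j. \<Sum>u\<in>{u \<in> {..<?R}. p u = x}. \<Sum>y<k. \<Sum>v\<in>{v \<in> {..<?C}. q v = y}. ?g u v)"
    by (intro sum.cong refl sum.swap)
  also have "\<dots> = (\<Sum>x<j. \<Sum>u\<in>{u \<in> {..<?R}. p u = x}. \<Sum>v<?C. ?g u v)"
    by (intro sum.cong refl sum.group qC) auto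
  also have "\<dots> = (\<Sum>u<?R. \<Sum>v<?C. ?g u v)"
    by (intro sum.group pR) auto
  also have "\<dots> =
      (\<Sum>u<dim_row a. \<Sum>v<dim_col a. ?g u v) +
      (\<Sum>u<dim_row b. \<Sum>v<dim_col b. ?g (dim_row a + u) (dim_col a + v))"
    by (simp add: sum_lessThan_add D)
  also have "\<dots> =
    chain_exponent a (fst (split_word (dim_row a) (dim_row b) p \<iota>),
                      fst (split_word (dim_col a) (dim_col b) q \<kappa>)) +
    chain_exponent b (snd (split_word (dim_row a) (dim_row b) p \<iota>),
                      snd (split_word (dim_col a) (dim_col b) q \<kappa>))"
    by (simp add: chain_exponent_def split_word_def D)
  finally show ?thesis .
qed

section \<open>The product formula\<close>

lemma dim_qsh_mat [simp]:
  "dim_row (qsh_mat a b j k p q) = j" "dim_col (qsh_mat a b j k p q) = k"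
  by (simp_all add: qsh_mat_def)

lemma qsh_index_iff:
  assumes "is_composition_mat a"
  shows "(j, k, p, q) \<in> qsh_index a b \<longleftrightarrow>
    p \<in> qSh (dim_row a) (dim_row b) j \<and> q \<in> qSh (dim_col a) (dim_col b) k"
proof -
  \<comment> \<open>A surjection from a non-empty set cannot have an empty target.\<close>
  have "1 \<le> i" if "f \<in> qSh r s i" "1 \<le> r" for f r s i
    using that by (cases i) (auto simp: qSh_def)
  with assms show ?thesis
    by (auto simp: qsh_index_def is_composition_mat_def)
qed

text \<open>
  The unique factorization of words is used twice, for the rows and for the columns. Of the four
  chains that result, the two belonging to \<open>a\<close> and the two belonging to \<open>b\<close> are then paired up.
\<close>

lemma card_product_chains:
  assumes a: "is_composition_mat a" and b: "is_composition_mat b"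
  shows "card (product_chains a b m) =
    (\<Sum>(j, k, p, q)\<in>qsh_index a b. card (chains_with_exponent (qsh_mat a b j k p q) m))"
proof -
  let ?rows = "split_word (dim_row a) (dim_row b)" and ?cols = "split_word (dim_col a) (dim_col b)"
  let ?T = "SIGMA (j, k, p, q):qsh_index a b. chains_with_exponent (qsh_mat a b j k p q) m"
  let ?G = "\<lambda>((j, k, p, q), (\<iota>, \<kappa>)).
    ((fst (?rows p \<iota>), fst (?cols q \<kappa>)), (snd (?rows p \<iota>), snd (?cols q \<kappa>)))"
  note T = qsh_index_iff[OF a] chains_with_exponent_def
  have "bij_betw ?G ?T (product_chains a b m)"
  proof (rule bij_betw_imageI)
    show "inj_on ?G ?T"
    proof (rule inj_onI)
      fix x x' assume "x \<in> ?T" "x' \<in> ?T" and eq: "?G x = ?G x'"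
      moreover obtain j k p q \<iota> \<kappa> where x: "x = ((j, k, p, q), (\<iota>, \<kappa>))" by (metis prod.exhaust)
      moreover obtain j' k' p' q' \<iota>' \<kappa>' where x': "x' = ((j', k', p', q'), (\<iota>', \<kappa>'))"
        by (metis prod.exhaust)
      ultimately have
        mem: "p \<in> qSh (dim_row a) (dim_row b) j" "q \<in> qSh (dim_col a) (dim_col b) k"
          "\<iota> \<in> index_chains j" "\<kappa> \<in> index_chains k" and
        mem': "p' \<in> qSh (dim_row a) (dim_row b) j'" "q' \<in> qSh (dim_col a) (dim_col b) k'"
          "\<iota>' \<in> index_chains j'" "\<kappa>' \<in> index_chains k'"
        by (simp_all add: T)
      have "?rows p \<iota> = ?rows p' \<iota>'" "?cols q \<kappa> = ?cols q' \<kappa>'"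
        using eq by (auto simp: x x' intro: prod_eqI)
      then show "x = x'"
        using split_word_inject[OF mem(1,3) mem'(1,3)] split_word_inject[OF mem(2,4) mem'(2,4)]
        by (simp add: x x')
    qed
    show "?G ` ?T = product_chains a b m"
    proof (intro equalityI subsetI)
      fix x assume "x \<in> ?G ` ?T"
      then obtain j k p q \<iota> \<kappa> where x: "x = ?G ((j, k, p, q), (\<iota>, \<kappa>))"
        and pq: "p \<in> qSh (dim_row a) (dim_row b) j" "q \<in> qSh (dim_col a) (dim_col b) k"
        and chains: "\<iota> \<in> index_chains j" "\<kappa> \<in> index_chains k"
        and m: "chain_exponent (qsh_mat a b j k p q) (\<iota>, \<kappa>) = m"
        by (auto simp: T)
      show "x \<in> product_chains a b m"
        using split_word_mem[OF pq(1) chains(1)] split_word_mem[OF pq(2) chains(2)]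
          chain_exponent_qsh_mat[OF pq, of \<iota> \<kappa>] m
        by (auto simp: x product_chains_def mem_Times_iff)
    next
      fix x assume "x \<in> product_chains a b m"
      then obtain \<alpha> \<beta> \<gamma> \<delta> where x: "x = ((\<alpha>, \<gamma>), (\<beta>, \<delta>))"
        and rows: "\<alpha> \<in> index_chains (dim_row a)" "\<beta> \<in> index_chains (dim_row b)"
        and cols: "\<gamma> \<in> index_chains (dim_col a)" "\<delta> \<in> index_chains (dim_col b)"
        and m: "chain_exponent a (\<alpha>, \<gamma>) + chain_exponent b (\<beta>, \<delta>) = m"
        by (auto simp: product_chains_def)
      obtain j p \<iota> where p: "p \<in> qSh (dim_row a) (dim_row b) j" "\<iota> \<in> index_chains j"
          "?rows p \<iota> = (\<alpha>, \<beta>)"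
        using rows by (rule split_word_surj)
      obtain k q \<kappa> where q: "q \<in> qSh (dim_col a) (dim_col b) k" "\<kappa> \<in> index_chains k"
          "?cols q \<kappa> = (\<gamma>, \<delta>)"
        using cols by (rule split_word_surj)
      have "chain_exponent (qsh_mat a b j k p q) (\<iota>, \<kappa>) = m"
        using chain_exponent_qsh_mat[OF p(1) q(1), of \<iota> \<kappa>] m by (simp add: p q)
      then have "((j, k, p, q), (\<iota>, \<kappa>)) \<in> ?T"
        using p q by (simp add: T)
      moreover have "x = ?G ((j, k, p, q), (\<iota>, \<kappa>))" by (simp add: x p q)
      ultimately show "x \<in> ?G ` ?T" by blast
    qed
  qed
  then have "card (product_chains a b m) = card ?T"
    by (simp add: bij_betw_same_card)
  also have "\<dots> = (\<Sum>(j, k, p, q)\<in>qsh_index a b. card (chains_with_exponent (qsh_mat a b j k p q) m))"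
    by (subst card_SigmaI)
       (auto simp: finite_qsh_index case_prod_unfold
         intro!: finite_chains_with_exponent is_composition_qsh_mat[OF a b])
  finally show ?thesis .
qed

lemma coeff_sum: "coeff (\<Sum>i\<in>A. f i) m = (\<Sum>i\<in>A. coeff (f i) m)"
  by (induction A rule: infinite_finite_induct) simp_all

lemma M_mat_mult:
  assumes "is_composition_mat a" "is_composition_mat b"
  shows "(M_mat a :: (nat \<times> nat, 'k::comm_ring_1) fps_findeg) * M_mat b =
    (\<Sum>(j, k, p, q)\<in>qsh_index a b. M_mat (qsh_mat a b j k p q))"
  by (rule fps_findeg_eqI)
     (simp add: coeff_M_mat_mult_card assms card_product_chains coeff_sum coeff_M_mat_card
       case_prod_unfold)

theorem theorem3p4:
  fixes a b :: matrix_composition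
  assumes "a \<in> Cmp" and "b \<in> Cmp"
  shows "(M a :: (nat \<times> nat, 'k::idom) fps_findeg) * M b =
    (case (a, b) of
       (Empty_Comp, _) \<Rightarrow> M b
     | (_, Empty_Comp) \<Rightarrow> M a
     | (Comp A, Comp B) \<Rightarrow> (\<Sum>(j, k, p, q)\<in>qsh_index A B. M (Comp (qsh_mat A B j k p q))))"
  using assms by (auto simp: Cmp_def M_mat_mult split: matrix_composition.splits)

end
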